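(* Let $A,\Pi\subset\mathbb{R}\setminus\{0\}$ be finite sets with $|\Pi|\geq|A|$, and let $T\geq 1$ be such that $r_{\Pi/\Pi}(a)\geq T$ for all $a\in A$. Then \[ |A+A|^{19}\,|\Pi|^{44}\geq |A|^{41-o(1)}\,T^{33}\,. \]
   Context: For finite sets $X,Y\subseteq\mathbb{R}\setminus\{0\}$ and $x\in\mathbb{R}$, $r_{X/Y}(x)=|\{(u,v)\in X\times Y: x=u/v\}|$ is the number of representations of $x$ as a ratio. $A+A=\{a+b:a,b\in A\}$. The term $o(1)$ denotes a quantity tending to $0$ as $|A|\to\infty$, uniformly in $\Pi$ and $T$. *)

theory Defs
  imports Complex_Main "HOL-Library.Set_Algebras"
begin

definition ratio_reps :: "real set \<Rightarrow> real set \<Rightarrow> real \<Rightarrow> nat" where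
  "ratio_reps X Y x = card {(u, v) \<in> X \<times> Y. x = u / v}"

end

theory Submission
  imports Defs "HOL-Analysis.Harmonic_Numbers" "HOL-Real_Asymp.Real_Asymp"
begin

text \<open>
  Put \<open>n = |A|\<close>, \<open>s = |A + A|\<close> and \<open>K = |\<Pi>|\<^sup>4 / T\<^sup>3\<close>. Writing \<open>a = p / q\<close>, a solution of
  \<open>x = a - b\<close> becomes an incidence between the point \<open>(x, 1 / q)\<close> and the line \<open>x + b = p u\<close>.
  The points form a Cartesian product, so the Szemeredi--Trotter bound follows from
  cutting the grid into \<open>r \<times> r\<close> cells, of which a line meets at most \<open>2 r\<close>. Hence at most
  \<open>O(K |B|\<^sup>2 / t\<^sup>3)\<close> differences \<open>x\<close> have \<open>t\<close> representations in \<open>A - B\<close>, and the third moment of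
  the number of representations is \<open>O(K |B|\<^sup>2 log n)\<close>.

  Let \<open>P\<close> be the \<open>m\<close> differences with at least \<open>t\<close> representations inside a large subset \<open>A'\<close> of
  \<open>A\<close>, any two elements of which share many partners forming popular sums. Counting triples with
  \<open>(a + b) - (b + c) = a - c \<in> P\<close> and both sums popular by Cauchy--Schwarz, the third moment and
  Hoelder gives \<open>m\<^sup>7 t\<^sup>1\<^sup>2 n\<^sup>9 \<lless> s\<^sup>1\<^sup>0 K\<^sup>9\<close> up to logarithms. Together with \<open>m t\<^sup>3 \<lless> K n\<^sup>2\<close> and the
  energy bound \<open>n\<^sup>4 / s \<lless> max\<^sub>t m t\<^sup>2\<close> this yields \<open>n\<^sup>4\<^sup>1 \<lless> s\<^sup>1\<^sup>9 K\<^sup>1\<^sup>1\<close>.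
\<close>

section \<open>Collisions of a map\<close>

definition collisions :: "('a \<Rightarrow> 'b) \<Rightarrow> 'a set \<Rightarrow> ('a \<times> 'a) set" where
  "collisions f X = {(x, y) \<in> X \<times> X. f x = f y}"

lemma finite_collisions: "finite X \<Longrightarrow> finite (collisions f X)"
  unfolding collisions_def by (rule finite_subset[of _ "X \<times> X"]) auto

lemma card_collisions:
  assumes "finite X"
  shows "card (collisions f X) = (\<Sum>x\<in>X. card {y\<in>X. f y = f x})"
proof -
  have "collisions f X = (SIGMA x:X. {y\<in>X. f y = f x})" by (auto simp: collisions_def)
  then show ?thesis using assms by simp
qed

lemma card_squared_le_card_image_mult_collisions:
  assumes "finite X"
  shows "(card X)\<^sup>2 \<le> card (f ` X) * card (collisions f X)"
proof -
  define k where "k y = card {x\<in>X. f x = y}" for y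
  have card_X: "card X = (\<Sum>y\<in>f ` X. k y)"
    using sum_fun_comp[of X "f ` X" f "\<lambda>_. 1::nat"] assms by (simp add: k_def)
  have card_coll: "card (collisions f X) = (\<Sum>y\<in>f ` X. (k y)\<^sup>2)"
    using sum_fun_comp[of X "f ` X" f k] assms
    by (simp add: card_collisions k_def power2_eq_square)
  have "(real (card X))\<^sup>2 \<le> (\<Sum>y\<in>f ` X. (real (k y))\<^sup>2) * card (f ` X)"
    unfolding card_X of_nat_sum by (rule sum_squared_le_sum_of_squares)
  also have "\<dots> = real (card (f ` X) * card (collisions f X))" by (simp add: card_coll)
  finally show ?thesis by (simp only: of_nat_power[symmetric] of_nat_le_iff)
qed

lemma card_le_card_image_add_collisions:
  assumes "finite X"
  shows "card X \<le> card (f ` X) + card (collisions f X - Id)"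
proof -
  define g where "g = inv_into X f"
  define Y where "Y = g ` f ` X"
  have representative: "g (f x) \<in> X" "f (g (f x)) = f x" if "x \<in> X" for x
    using that by (auto simp: g_def inv_into_into f_inv_into_f)
  have "card (X - Y) \<le> card (collisions f X - Id)"
  proof (rule card_inj_on_le)
    show "inj_on (\<lambda>x. (x, g (f x))) (X - Y)" by (auto simp: inj_on_def)
    show "(\<lambda>x. (x, g (f x))) ` (X - Y) \<subseteq> collisions f X - Id"
      using representative by (auto simp: Y_def collisions_def)
  qed (use assms in \<open>auto intro: finite_collisions\<close>)
  moreover have "card Y \<le> card (f ` X)"
    unfolding Y_def by (rule card_image_le) (use assms in auto)
  moreover have "card X \<le> card Y + card (X - Y)"
    using card_Un_le[of Y "X - Y"] card_mono[of "Y \<union> (X - Y)" X] assms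
    by (simp add: Y_def)
  ultimately show ?thesis by linarith
qed

lemma card_collisions_map_prod:
  "card (collisions (map_prod f g) (X \<times> Y)) = card (collisions f X) * card (collisions g Y)"
proof -
  let ?transpose = "\<lambda>((x, y), (x', y')). ((x, x'), (y, y'))"
  have "collisions f X \<times> collisions g Y = ?transpose ` collisions (map_prod f g) (X \<times> Y)"
    by (force simp: collisions_def image_iff)
  moreover have "inj_on ?transpose (collisions (map_prod f g) (X \<times> Y))"
    by (auto simp: inj_on_def)
  ultimately show ?thesis by (simp add: card_image flip: card_cartesian_product)
qed


section \<open>Inequalities for finite sums\<close>

lemma Cauchy_Schwarz_weighted_sum:
  fixes f g w :: "'a \<Rightarrow> real"
  assumes "\<And>x. x \<in> X \<Longrightarrow> w x \<ge> 0"
  shows "(\<Sum>x\<in>X. w x * f x * g x)\<^sup>2 \<le> (\<Sum>x\<in>X. w x * (f x)\<^sup>2) * (\<Sum>x\<in>X. w x * (g x)\<^sup>2)"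
proof -
  have "(\<Sum>x\<in>X. (sqrt (w x) * f x) * (sqrt (w x) * g x))\<^sup>2
      \<le> (\<Sum>x\<in>X. (sqrt (w x) * f x)\<^sup>2) * (\<Sum>x\<in>X. (sqrt (w x) * g x)\<^sup>2)"
    by (rule Cauchy_Schwarz_ineq_sum)
  moreover have "sqrt (w x) * f x * (sqrt (w x) * g x) = w x * f x * g x" if "x \<in> X" for x
    using real_sqrt_mult_self[of "w x"] assms[OF that] by (simp add: mult_ac)
  ultimately show ?thesis
    using assms by (simp add: power_mult_distrib cong: sum.cong)
qed

text \<open>Hoelder's inequality with exponents 3 and 3/2, by eliminating \<open>Z\<close> from two applications of
  Cauchy--Schwarz.\<close>

lemma sum_mult_square_cubed_le:
  fixes u v :: "'a \<Rightarrow> real"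
  assumes u: "\<And>x. x \<in> X \<Longrightarrow> u x \<ge> 0" and v: "\<And>x. x \<in> X \<Longrightarrow> v x \<ge> 0"
  shows "(\<Sum>x\<in>X. u x * (v x)\<^sup>2) ^ 3 \<le> (\<Sum>x\<in>X. u x ^ 3) * (\<Sum>x\<in>X. v x ^ 3)\<^sup>2"
proof -
  define Y Z U V where "Y = (\<Sum>x\<in>X. u x * (v x)\<^sup>2)" and "Z = (\<Sum>x\<in>X. (u x)\<^sup>2 * v x)"
    and "U = (\<Sum>x\<in>X. u x ^ 3)" and "V = (\<Sum>x\<in>X. v x ^ 3)"
  have nonneg: "Y \<ge> 0" "U \<ge> 0" "V \<ge> 0" "Z \<ge> 0"
    unfolding Y_def U_def V_def Z_def using u v by (auto intro!: sum_nonneg)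
  have Y_le: "Y\<^sup>2 \<le> V * Z"
    using Cauchy_Schwarz_weighted_sum[of X v v u] v
    by (simp add: Y_def V_def Z_def power2_eq_square power3_eq_cube mult_ac)
  have Z_le: "Z\<^sup>2 \<le> U * Y"
    using Cauchy_Schwarz_weighted_sum[of X u u v] u
    by (simp add: Y_def U_def Z_def power2_eq_square power3_eq_cube mult_ac)
  have "Y * Y ^ 3 = (Y\<^sup>2)\<^sup>2" by (simp add: power2_eq_square power3_eq_cube)
  also have "\<dots> \<le> (V * Z)\<^sup>2" using Y_le by (rule power_mono) simp
  also have "\<dots> \<le> V\<^sup>2 * (U * Y)"
    unfolding power_mult_distrib using Z_le by (rule mult_left_mono) simp
  finally have "Y * Y ^ 3 \<le> Y * (U * V\<^sup>2)" by (simp add: mult_ac)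
  then have "Y ^ 3 \<le> U * V\<^sup>2" using nonneg by (cases "Y = 0") (auto simp: mult_le_cancel_left)
  then show ?thesis by (simp only: Y_def U_def V_def)
qed

lemma sum_mult_power6_le:
  fixes u v :: "'a \<Rightarrow> real"
  assumes u: "\<And>x. x \<in> X \<Longrightarrow> u x \<ge> 0" and v: "\<And>x. x \<in> X \<Longrightarrow> v x \<ge> 0"
  shows "(\<Sum>x\<in>X. u x * v x) ^ 6 \<le> (\<Sum>x\<in>X. u x) ^ 3 * (\<Sum>x\<in>X. u x ^ 3) * (\<Sum>x\<in>X. v x ^ 3)\<^sup>2"
proof -
  have "(\<Sum>x\<in>X. u x * v x) ^ 6 = ((\<Sum>x\<in>X. u x * v x)\<^sup>2) ^ 3" by (simp flip: power_mult)
  also have "\<dots> \<le> ((\<Sum>x\<in>X. u x) * (\<Sum>x\<in>X. u x * (v x)\<^sup>2)) ^ 3"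
    using Cauchy_Schwarz_weighted_sum[of X u "\<lambda>_. 1" v] u by (intro power_mono) auto
  also have "\<dots> = (\<Sum>x\<in>X. u x) ^ 3 * (\<Sum>x\<in>X. u x * (v x)\<^sup>2) ^ 3" by (rule power_mult_distrib)
  also have "\<dots> \<le> (\<Sum>x\<in>X. u x) ^ 3 * ((\<Sum>x\<in>X. u x ^ 3) * (\<Sum>x\<in>X. v x ^ 3)\<^sup>2)"
    by (intro mult_left_mono sum_mult_square_cubed_le zero_le_power sum_nonneg u v)
  finally show ?thesis by (simp only: mult.assoc)
qed

lemma Suc_power_le: "Suc m ^ k \<le> m ^ k + k * Suc m ^ (k - 1)"
proof (induction k)
  case (Suc k)
  have "Suc m ^ Suc k \<le> Suc m * (m ^ k + k * Suc m ^ (k - 1))"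
    using Suc by (simp only: power_Suc) (rule mult_le_mono2)
  also have "\<dots> = m ^ Suc k + (m ^ k + k * (Suc m * Suc m ^ (k - 1)))"
    by (simp add: algebra_simps)
  also have "k * (Suc m * Suc m ^ (k - 1)) = k * Suc m ^ k"
    by (cases k) auto
  also have "m ^ k \<le> Suc m ^ k" by (rule power_mono) auto
  finally show ?case by (simp add: algebra_simps)
qed simp

lemma power_le_sum_layers: "m ^ k \<le> (\<Sum>t=1..m. k * t ^ (k - 1))" if "k > 0"
proof (induction m)
  case (Suc m)
  then show ?case using Suc_power_le[of m k] by simp
qed (use that in simp)

lemma sum_power_le_harm:
  fixes f :: "'a \<Rightarrow> nat" and C :: real
  assumes "finite X" "k > 0" and bounded: "\<And>x. x \<in> X \<Longrightarrow> f x \<le> n"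
    and level: "\<And>t. t \<in> {1..n} \<Longrightarrow> card {x\<in>X. t \<le> f x} * real t ^ k \<le> C"
  shows "real (\<Sum>x\<in>X. f x ^ k) \<le> k * C * harm n"
proof -
  have "(\<Sum>x\<in>X. f x ^ k) \<le> (\<Sum>x\<in>X. \<Sum>t=1..n. if t \<le> f x then k * t ^ (k - 1) else 0)"
  proof (rule sum_mono)
    fix x assume "x \<in> X"
    then have "{1..n} \<inter> {t. t \<le> f x} = {1..f x}" using bounded[of x] by auto
    then show "f x ^ k \<le> (\<Sum>t=1..n. if t \<le> f x then k * t ^ (k - 1) else 0)"
      using power_le_sum_layers[OF \<open>k > 0\<close>, of "f x"] by (simp add: sum.If_cases)
  qed
  also have "\<dots> = (\<Sum>t=1..n. \<Sum>x\<in>X. if t \<le> f x then k * t ^ (k - 1) else 0)"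
    by (rule sum.swap)
  also have "\<dots> = (\<Sum>t=1..n. k * t ^ (k - 1) * card {x\<in>X. t \<le> f x})"
    using \<open>finite X\<close> by (simp add: sum.If_cases Int_def mult_ac)
  finally have "real (\<Sum>x\<in>X. f x ^ k) \<le> real (\<Sum>t=1..n. k * t ^ (k - 1) * card {x\<in>X. t \<le> f x})"
    by (rule of_nat_mono)
  also have "\<dots> = (\<Sum>t=1..n. k * (card {x\<in>X. t \<le> f x} * real t ^ k) * inverse (real t))"
    unfolding of_nat_sum using power_minus_mult[OF \<open>k > 0\<close>, of "real _"]
    by (intro sum.cong) (auto simp: field_simps)
  also have "\<dots> \<le> (\<Sum>t=1..n. k * C * inverse (real t))"
    by (intro sum_mono mult_right_mono mult_left_mono level) auto
  also have "\<dots> = k * C * harm n" by (simp add: harm_def sum_distrib_left)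
  finally show ?thesis .
qed


section \<open>Incidences between lines and Cartesian products\<close>

definition line :: "'a::field \<Rightarrow> 'a \<Rightarrow> ('a \<times> 'a) set" where
  "line p b = {(x, u). x + b = p * u}"

definition incidences :: "('a::field \<times> 'a) set \<Rightarrow> ('a \<times> 'a) set \<Rightarrow> nat" where
  "incidences Q L = (\<Sum>(p, b)\<in>L. card (Q \<inter> line p b))"

lemma incidences_eq_card_Sigma:
  assumes "finite Q" "finite L"
  shows "incidences Q L = card (SIGMA (p, b):L. Q \<inter> line p b)"
  unfolding incidences_def using assms by (subst card_SigmaI) (auto intro!: sum.cong)

lemma line_unique:
  assumes "z \<in> line p b" "w \<in> line p b" "z \<in> line p' b'" "w \<in> line p' b'" "z \<noteq> w"
  shows "p = p' \<and> b = b'"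
proof -
  obtain x u y v where coords: "z = (x, u)" "w = (y, v)" by (metis surj_pair)
  have on_line: "p * u = x + b" "p * v = y + b" "p' * u = x + b'" "p' * v = y + b'"
    using assms by (auto simp: line_def coords)
  then have "(p - p') * (u - v) = 0" by (simp add: left_diff_distrib right_diff_distrib)
  moreover have "u \<noteq> v" using on_line assms(5) by (auto simp: coords)
  ultimately show ?thesis using on_line by auto
qed

lemma incidences_le_cells:
  assumes "finite Q" "finite L"
    and cells: "\<And>p b. (p, b) \<in> L \<Longrightarrow> card (c ` (Q \<inter> line p b)) \<le> k"
  shows "incidences Q L \<le> k * card L + card (collisions c Q)"
proof -
  define coll where "coll = (\<lambda>(p, b). collisions c (Q \<inter> line p b) - Id)"
  have finite_coll: "finite (coll l)" for l
    using assms by (auto simp: coll_def finite_collisions split: prod.split)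
  have "incidences Q L \<le> (\<Sum>l\<in>L. k + card (coll l))"
    unfolding incidences_def
  proof (intro sum_mono, clarify)
    fix p b assume "(p, b) \<in> L"
    then show "card (Q \<inter> line p b) \<le> k + card (coll (p, b))"
      using card_le_card_image_add_collisions[of "Q \<inter> line p b" c] cells[of p b] assms(1)
      by (simp add: coll_def)
  qed
  also have "\<dots> = k * card L + card (SIGMA l:L. coll l)"
    using assms(2) finite_coll by (simp add: sum.distrib)
  also have "card (SIGMA l:L. coll l) \<le> card (collisions c Q)"
  proof (rule card_inj_on_le[of snd])
    show "inj_on snd (SIGMA l:L. coll l)"
      by (auto simp: inj_on_def coll_def collisions_def dest: line_unique)
    show "snd ` (SIGMA l:L. coll l) \<subseteq> collisions c Q"
      by (auto simp: coll_def collisions_def)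
  qed (rule finite_collisions[OF assms(1)])
  finally show ?thesis by simp
qed

text \<open>The blocks cut the increasing enumeration of \<open>D\<close> into \<open>r\<close> runs of nearly equal length.\<close>

definition block :: "nat \<Rightarrow> 'a::linorder set \<Rightarrow> 'a \<Rightarrow> nat" where
  "block r D x = card {y\<in>D. y < x} * r div card D"

lemma block_less:
  assumes "finite D" "x \<in> D" "r > 0"
  shows "block r D x < r"
proof -
  have "card {y\<in>D. y < x} < card D"
    by (rule psubset_card_mono) (use assms in auto)
  then show ?thesis
    unfolding block_def using \<open>r > 0\<close> by (intro less_mult_imp_div_less) (simp add: mult.commute)
qed

lemma block_mono:
  assumes "finite D" "x \<le> y"
  shows "block r D x \<le> block r D y"
  unfolding block_def
  by (intro div_le_mono mult_le_mono1 card_mono) (use assms in auto)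

lemma block_less_imp_less: "finite D \<Longrightarrow> block r D x < block r D y \<Longrightarrow> x < y"
  by (meson block_mono not_le)

lemma card_block_le:
  assumes "finite D" "r > 0" "r \<le> card D"
  shows "card {x\<in>D. block r D x = k} * r \<le> 2 * card D"
proof -
  define N rank where "N = card D" and "rank x = card {y\<in>D. y < x}" for x
  have "N > 0" using assms by (simp add: N_def)
  have rank_less: "rank x < rank y" if "x \<in> D" "x < y" for x y
    unfolding rank_def by (rule psubset_card_mono) (use that assms in auto)
  have rank_eqD: "x = y" if "x \<in> D" "y \<in> D" "rank x = rank y" for x y
    using rank_less[of x y] rank_less[of y x] that by (cases x y rule: linorder_cases) auto
  have rank_block: "k * N \<le> rank x * r \<and> rank x * r < k * N + N" if "block r D x = k" for x
  proof -
    have "k = rank x * r div N" using that by (simp add: block_def rank_def N_def)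
    then have "k * N + rank x * r mod N = rank x * r" by simp
    then show ?thesis using mod_less_divisor[OF \<open>N > 0\<close>, of "rank x * r"] by linarith
  qed
  have "card ({x\<in>D. block r D x = k} \<times> {..<r}) \<le> card {k * N..<k * N + N + r}"
  proof (rule card_inj_on_le[of "\<lambda>(x, i). rank x * r + i"])
    show "inj_on (\<lambda>(x, i). rank x * r + i) ({x\<in>D. block r D x = k} \<times> {..<r})"
    proof (rule inj_onI, clarify)
      fix x i y j
      assume "x \<in> D" "y \<in> D" "i < r" "j < r" and same_value: "rank x * r + i = rank y * r + j"
      have "rank x = (rank x * r + i) div r" using \<open>i < r\<close> by simp
      also have "\<dots> = rank y" unfolding same_value using \<open>j < r\<close> by simp
      finally have "rank x = rank y" .
      then show "x = y \<and> i = j" using rank_eqD same_value \<open>x \<in> D\<close> \<open>y \<in> D\<close> by simp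
    qed
    show "(\<lambda>(x, i). rank x * r + i) ` ({x\<in>D. block r D x = k} \<times> {..<r}) \<subseteq> {k * N..<k * N + N + r}"
    proof (rule image_subsetI)
      fix z assume "z \<in> {x\<in>D. block r D x = k} \<times> {..<r}"
      then obtain x i where "z = (x, i)" "block r D x = k" "i < r" by auto
      then show "(\<lambda>(x, i). rank x * r + i) z \<in> {k * N..<k * N + N + r}"
        using rank_block[of x] by simp
    qed
  qed simp
  then show ?thesis using assms by (simp add: card_cartesian_product N_def)
qed

lemma card_collisions_block_le:
  assumes "finite D" "r > 0" "r \<le> card D"
  shows "card (collisions (block r D) D) * r \<le> 2 * (card D)\<^sup>2"
proof -
  have "card (collisions (block r D) D) * r = (\<Sum>x\<in>D. card {y\<in>D. block r D y = block r D x} * r)"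
    by (simp add: card_collisions assms sum_distrib_right)
  also have "\<dots> \<le> (\<Sum>x\<in>D. 2 * card D)" by (intro sum_mono card_block_le assms)
  finally show ?thesis by (simp add: power2_eq_square)
qed

lemma card_monotone_cells_le:
  assumes "S \<subseteq> {..<r} \<times> {..<r}"
    and mono: "\<And>i j i' j'. (i, j) \<in> S \<Longrightarrow> (i', j') \<in> S \<Longrightarrow> i < i' \<Longrightarrow> j \<le> j'"
  shows "card S \<le> 2 * r"
proof -
  have "inj_on (\<lambda>(i, j). i + j) S"
  proof (rule inj_onI, clarify)
    fix i j i' j' assume "(i, j) \<in> S" "(i', j') \<in> S" "i + j = i' + j'"
    then show "i = i' \<and> j = j'"
      using mono[of i j i' j'] mono[of i' j' i j] by (cases i i' rule: linorder_cases) auto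
  qed
  moreover have "i + j < 2 * r" if "(i, j) \<in> S" for i j
    using subsetD[OF assms(1) that] by simp
  then have "(\<lambda>(i, j). i + j) ` S \<subseteq> {..<2 * r}" by auto
  ultimately have "card S \<le> card {..<2 * r}" by (intro card_inj_on_le) auto
  then show ?thesis by simp
qed

lemma card_antitone_cells_le:
  assumes "S \<subseteq> {..<r} \<times> {..<r}"
    and anti: "\<And>i j i' j'. (i, j) \<in> S \<Longrightarrow> (i', j') \<in> S \<Longrightarrow> i < i' \<Longrightarrow> j' \<le> j"
  shows "card S \<le> 2 * r"
proof -
  let ?reflect = "\<lambda>(i, j). (i, r - Suc j)"
  have less: "i < r" "j < r" if "(i, j) \<in> S" for i j using subsetD[OF assms(1) that] by auto
  have "inj_on ?reflect S"
  proof (rule inj_onI, clarsimp)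
    fix i j j' assume "(i, j) \<in> S" "(i, j') \<in> S" "r - Suc j = r - Suc j'"
    then show "j = j'" using less[of i j] less[of i j'] by linarith
  qed
  then have "card S = card (?reflect ` S)" by (simp add: card_image)
  also have "\<dots> \<le> 2 * r"
  proof (rule card_monotone_cells_le)
    show "?reflect ` S \<subseteq> {..<r} \<times> {..<r}" using less by fastforce
    fix i j i' j' assume "(i, j) \<in> ?reflect ` S" "(i', j') \<in> ?reflect ` S" "i < i'"
    then obtain k k' where "(i, k) \<in> S" "(i', k') \<in> S" "j = r - Suc k" "j' = r - Suc k'" by auto
    then show "j \<le> j'" using anti[of i k i' k'] \<open>i < i'\<close> by simp
  qed
  finally show ?thesis .
qed

lemma block_less_on_line:
  fixes D :: "'a::linordered_field set"
  assumes "finite D" "(x, u) \<in> line p b" "(y, v) \<in> line p b" "block r D x < block r D y"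
  shows "p * u < p * v"
proof -
  have "x < y" using assms(1,4) by (rule block_less_imp_less)
  moreover have "p * u = x + b" "p * v = y + b" using assms(2,3) by (auto simp: line_def)
  ultimately show ?thesis by (simp only: add_less_cancel_right)
qed

lemma card_cells_on_line_le:
  fixes D U :: "'a::linordered_field set"
  assumes "finite D" "finite U" "r > 0"
  shows "card (map_prod (block r D) (block r U) ` (D \<times> U \<inter> line p b)) \<le> 2 * r"
    (is "card ?S \<le> _")
proof -
  have S_subset: "?S \<subseteq> {..<r} \<times> {..<r}"
    by (auto intro: block_less assms)
  have ordinates: "\<exists>u v. j = block r U u \<and> j' = block r U v \<and> p * u < p * v"
    if "(i, j) \<in> ?S" "(i', j') \<in> ?S" "i < i'" for i j i' j'
    using that block_less_on_line[OF assms(1)] by blast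
  show ?thesis
  proof (cases "p \<ge> 0")
    case True
    then have "u \<le> v" if "p * u < p * v" for u v using that mult_left_mono[of v u p] by force
    then have "j \<le> j'" if "(i, j) \<in> ?S" "(i', j') \<in> ?S" "i < i'" for i j i' j'
      using ordinates[OF that] block_mono[OF assms(2)] by blast
    then show ?thesis by (rule card_monotone_cells_le[OF S_subset])
  next
    case False
    then have "v \<le> u" if "p * u < p * v" for u v using that mult_left_mono_neg[of u v p] by force
    then have "j' \<le> j" if "(i, j) \<in> ?S" "(i', j') \<in> ?S" "i < i'" for i j i' j'
      using ordinates[OF that] block_mono[OF assms(2)] by blast
    then show ?thesis by (rule card_antitone_cells_le[OF S_subset])
  qed
qed

lemma incidences_grid_le_partition:
  fixes D U :: "'a::linordered_field set"
  assumes fin: "finite D" "finite U" "finite L" and r: "r > 0" "r \<le> card D" "r \<le> card U"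
  shows "incidences (D \<times> U) L * r\<^sup>2 \<le> 2 * r ^ 3 * card L + 4 * (card D * card U)\<^sup>2"
proof -
  define N where "N = card (collisions (block r D) D) * card (collisions (block r U) U)"
  have "N * r\<^sup>2 = (card (collisions (block r D) D) * r) * (card (collisions (block r U) U) * r)"
    by (simp add: N_def power2_eq_square mult_ac)
  also have "\<dots> \<le> (2 * (card D)\<^sup>2) * (2 * (card U)\<^sup>2)"
    by (intro mult_le_mono card_collisions_block_le fin r)
  finally have N_le: "N * r\<^sup>2 \<le> 4 * (card D * card U)\<^sup>2" by (simp add: power_mult_distrib)
  have "incidences (D \<times> U) L \<le> 2 * r * card L + N"
    unfolding N_def card_collisions_map_prod[symmetric]
    by (intro incidences_le_cells card_cells_on_line_le) (use fin r in auto)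
  then have "incidences (D \<times> U) L * r\<^sup>2 \<le> (2 * r * card L + N) * r\<^sup>2" by (rule mult_le_mono1)
  also have "\<dots> = 2 * r ^ 3 * card L + N * r\<^sup>2"
    by (simp add: power2_eq_square power3_eq_cube algebra_simps)
  also have "\<dots> \<le> 2 * r ^ 3 * card L + 4 * (card D * card U)\<^sup>2" using N_le by simp
  finally show ?thesis .
qed

lemma incidences_grid_le_min:
  assumes "finite D" "finite U" "\<And>p b. (p, b) \<in> L \<Longrightarrow> p \<noteq> 0"
  shows "incidences (D \<times> U) L \<le> min (card D) (card U) * card L"
proof -
  have "card (D \<times> U \<inter> line p b) \<le> min (card D) (card U)" if "(p, b) \<in> L" for p b
  proof -
    have "card (D \<times> U \<inter> line p b) \<le> card D"
      by (rule card_inj_on_le[of fst]) (use assms that in \<open>auto simp: inj_on_def line_def\<close>)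
    moreover have "card (D \<times> U \<inter> line p b) \<le> card U"
      by (rule card_inj_on_le[of snd])
        (use assms in \<open>auto simp: inj_on_def line_def eq_diff_eq[symmetric]\<close>)
    ultimately show ?thesis by simp
  qed
  then show ?thesis
    unfolding incidences_def using sum_bounded_above[of L _ "min (card D) (card U)"]
    by (fastforce simp: mult.commute)
qed

lemma Szemeredi_Trotter_grid:
  fixes D U :: "'a::linordered_field set"
  assumes fin: "finite D" "finite U" "finite L" and L: "\<And>p b. (p, b) \<in> L \<Longrightarrow> p \<noteq> 0"
    and rich: "4 * card L < incidences (D \<times> U) L"
  shows "incidences (D \<times> U) L ^ 3 \<le> 512 * (card D * card U * card L)\<^sup>2"
proof -
  define I l r where "I = incidences (D \<times> U) L" and "l = card L" and "r = I div (4 * l)"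
  have I_gt: "4 * l < I" using rich by (simp add: I_def l_def)
  have I_le: "I \<le> min (card D) (card U) * l"
    unfolding I_def l_def using fin(1,2) L by (rule incidences_grid_le_min)
  have "l > 0" using I_gt I_le by (cases l) auto
  then have "r > 0" using I_gt by (simp add: r_def div_greater_zero_iff)
  have r_upper: "4 * l * r \<le> I" by (simp add: r_def)
  have "I < 4 * l * Suc r" using dividend_less_times_div[of "4 * l" I] \<open>l > 0\<close> by (simp add: r_def)
  also have "\<dots> \<le> 8 * l * r" using \<open>r > 0\<close> by (cases r) auto
  finally have r_lower: "I \<le> 8 * l * r" by simp
  have "r * l \<le> 4 * l * r" by simp
  also have "\<dots> \<le> min (card D) (card U) * l" using r_upper I_le by linarith
  finally have "r * l \<le> min (card D) (card U) * l" .
  then have r_le: "r \<le> card D" "r \<le> card U" using \<open>l > 0\<close> by auto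
  have "I * r\<^sup>2 \<le> 2 * r ^ 3 * l + 4 * (card D * card U)\<^sup>2"
    unfolding I_def l_def by (intro incidences_grid_le_partition fin \<open>r > 0\<close> r_le)
  moreover have "4 * r ^ 3 * l \<le> I * r\<^sup>2"
    using mult_le_mono1[OF r_upper, of "r\<^sup>2"] by (simp add: power2_eq_square power3_eq_cube mult_ac)
  ultimately have I_r: "I * r\<^sup>2 \<le> 8 * (card D * card U)\<^sup>2" by linarith
  have "I ^ 3 = I * I\<^sup>2" by (simp add: power3_eq_cube power2_eq_square)
  also have "\<dots> \<le> I * (8 * l * r)\<^sup>2" using r_lower by (intro mult_le_mono2 power_mono) auto
  also have "\<dots> = 64 * l\<^sup>2 * (I * r\<^sup>2)" by (simp add: power_mult_distrib)
  also have "\<dots> \<le> 64 * l\<^sup>2 * (8 * (card D * card U)\<^sup>2)" using I_r by (rule mult_le_mono2)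
  finally show ?thesis
    by (simp add: I_def l_def power_mult_distrib mult_ac)
qed


section \<open>Representations of differences\<close>

definition diff_fiber :: "'a::ab_group_add set \<Rightarrow> 'a set \<Rightarrow> 'a \<Rightarrow> 'a set" where
  "diff_fiber A B x = {a\<in>A. a - x \<in> B}"

definition diff_reps :: "'a::ab_group_add set \<Rightarrow> 'a set \<Rightarrow> 'a \<Rightarrow> nat" where
  "diff_reps A B x = card (diff_fiber A B x)"

definition diff_set :: "'a::ab_group_add set \<Rightarrow> 'a set \<Rightarrow> 'a set" where
  "diff_set A B = (\<lambda>(a, b). a - b) ` (A \<times> B)"

definition popular_diffs :: "'a::ab_group_add set \<Rightarrow> 'a set \<Rightarrow> nat \<Rightarrow> 'a set" where
  "popular_diffs A B t = {x. t \<le> diff_reps A B x}"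

definition additive_energy :: "nat \<Rightarrow> 'a::ab_group_add set \<Rightarrow> 'a set \<Rightarrow> nat" where
  "additive_energy k A B = (\<Sum>x\<in>diff_set A B. diff_reps A B x ^ k)"

lemma finite_diff_fiber [simp]: "finite A \<Longrightarrow> finite (diff_fiber A B x)"
  by (simp add: diff_fiber_def)

lemma finite_diff_set [simp]: "finite A \<Longrightarrow> finite B \<Longrightarrow> finite (diff_set A B)"
  by (simp add: diff_set_def)

lemma diff_fiber_imp_diff_set: "a \<in> diff_fiber A B x \<Longrightarrow> x \<in> diff_set A B"
  unfolding diff_fiber_def diff_set_def by (rule image_eqI[of _ _ "(a, a - x)"]) auto

lemma diff_reps_eq_0: "x \<notin> diff_set A B \<Longrightarrow> diff_reps A B x = 0"
  using diff_fiber_imp_diff_set[of _ A B x] by (auto simp: diff_reps_def card_eq_0_iff)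

lemma diff_reps_minus: "diff_reps A B (- x) = diff_reps B A x"
proof -
  have "bij_betw (\<lambda>a. a + x) (diff_fiber A B (- x)) (diff_fiber B A x)"
    by (rule bij_betw_byWitness[where f' = "\<lambda>b. b - x"]) (auto simp: diff_fiber_def)
  then show ?thesis unfolding diff_reps_def by (rule bij_betw_same_card)
qed

lemma diff_reps_mono:
  assumes "finite A" "A' \<subseteq> A" "B' \<subseteq> B"
  shows "diff_reps A' B' x \<le> diff_reps A B x"
  unfolding diff_reps_def by (rule card_mono) (use assms in \<open>auto simp: diff_fiber_def\<close>)

lemma diff_reps_le_card_left: "finite A \<Longrightarrow> diff_reps A B x \<le> card A"
  unfolding diff_reps_def diff_fiber_def by (rule card_mono) auto

lemma diff_reps_le_card_right: "finite B \<Longrightarrow> diff_reps A B x \<le> card B"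
  using diff_reps_le_card_left[of B A "- x"] by (simp add: diff_reps_minus)

lemma popular_diffs_subset_diff_set: "t > 0 \<Longrightarrow> popular_diffs A B t \<subseteq> diff_set A B"
  using diff_reps_eq_0 by (fastforce simp: popular_diffs_def)

lemma finite_popular_diffs: "finite A \<Longrightarrow> finite B \<Longrightarrow> t > 0 \<Longrightarrow> finite (popular_diffs A B t)"
  by (meson finite_diff_set finite_subset popular_diffs_subset_diff_set)

lemma sum_diff_reps_power_le_additive_energy:
  assumes "finite A" "finite B" "finite X" "k > 0"
  shows "(\<Sum>x\<in>X. diff_reps A B x ^ k) \<le> additive_energy k A B"
proof -
  have "(\<Sum>x\<in>X. diff_reps A B x ^ k) \<le> (\<Sum>x\<in>X \<union> diff_set A B. diff_reps A B x ^ k)"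
    using assms by (intro sum_mono2) auto
  also have "\<dots> = additive_energy k A B"
    unfolding additive_energy_def
    using assms by (intro sum.mono_neutral_right) (auto simp: diff_reps_eq_0)
  finally show ?thesis .
qed

lemma additive_energy_commute: "additive_energy k A B = additive_energy k B A"
proof -
  have "diff_set B A = uminus ` diff_set A B" by (force simp: diff_set_def image_iff)
  then show ?thesis
    by (simp add: additive_energy_def sum.reindex diff_reps_minus)
qed

lemma additive_energy_1:
  assumes "finite A" "finite B"
  shows "additive_energy 1 A B = card A * card B"
proof -
  have fiber: "card {q \<in> A \<times> B. (\<lambda>(a, b). a - b) q = x} = diff_reps A B x" for x
  proof -
    have "{q \<in> A \<times> B. (\<lambda>(a, b). a - b) q = x} = (\<lambda>a. (a, a - x)) ` diff_fiber A B x"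
      by (auto simp: diff_fiber_def image_iff)
    then show ?thesis by (simp add: diff_reps_def card_image inj_on_def)
  qed
  have "card (A \<times> B) = (\<Sum>x\<in>diff_set A B. card {q \<in> A \<times> B. (\<lambda>(a, b). a - b) q = x})"
    using sum_fun_comp[of "A \<times> B" "diff_set A B" "\<lambda>(a, b). a - b" "\<lambda>_. 1::nat"] assms
    by (simp add: diff_set_def)
  then show ?thesis by (simp add: additive_energy_def fiber card_cartesian_product)
qed

lemma additive_energy_le_harm:
  fixes C :: real
  assumes "finite A" "finite B" "k > 0"
    and level: "\<And>t. t > 0 \<Longrightarrow> card (popular_diffs A B t) * real t ^ k \<le> C"
  shows "additive_energy k A B \<le> k * C * harm (card A)"
  unfolding additive_energy_def
proof (rule sum_power_le_harm)
  fix t assume t: "t \<in> {1..card A}"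
  have "card {x \<in> diff_set A B. t \<le> diff_reps A B x} \<le> card (popular_diffs A B t)"
    using assms(1,2) t by (intro card_mono finite_popular_diffs) (auto simp: popular_diffs_def)
  then have "card {x \<in> diff_set A B. t \<le> diff_reps A B x} * real t ^ k
      \<le> card (popular_diffs A B t) * real t ^ k"
    by (intro mult_right_mono) auto
  also have "\<dots> \<le> C" using t by (intro level) auto
  finally show "card {x \<in> diff_set A B. t \<le> diff_reps A B x} * real t ^ k \<le> C" .
qed (use assms in \<open>auto simp: diff_reps_le_card_left\<close>)

lemma card_sum_collisions_le:
  fixes A B :: "'a::ab_group_add set"
  assumes "finite A" "finite B"
  shows "card (collisions (\<lambda>(a, b). a + b) (A \<times> B)) \<le> additive_energy 2 A B"
proof -
  let ?quadruple = "\<lambda>(x, a, a'). ((a, a' - x), (a', a - x))"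
  let ?F = "diff_fiber A B"
  let ?E = "SIGMA x:diff_set A B. ?F x \<times> ?F x"
  have "collisions (\<lambda>(a, b). a + b) (A \<times> B) \<subseteq> ?quadruple ` ?E"
  proof
    fix q assume "q \<in> collisions (\<lambda>(a, b). a + b) (A \<times> B)"
    then obtain a b a' b' where q_eq: "q = ((a, b), (a', b'))"
      and mem: "a \<in> A" "b \<in> B" "a' \<in> A" "b' \<in> B" and same_sum: "a + b = a' + b'"
      by (auto simp: collisions_def)
    obtain x where a_eq: "a = b' + x" by (metis diff_add_cancel add.commute)
    then have a'_eq: "a' = b + x" using same_sum by (simp add: add_ac)
    have "a \<in> ?F x" "a' \<in> ?F x" using mem by (auto simp: diff_fiber_def a_eq a'_eq)
    then show "q \<in> ?quadruple ` ?E"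
      using diff_fiber_imp_diff_set[of a A B x]
      by (intro image_eqI[of _ _ "(x, a, a')"]) (auto simp: q_eq a_eq a'_eq)
  qed
  then have "card (collisions (\<lambda>(a, b). a + b) (A \<times> B)) \<le> card ?E"
    by (rule surj_card_le[rotated]) (use assms in auto)
  also have "\<dots> = additive_energy 2 A B"
    using assms
    by (simp add: additive_energy_def diff_reps_def card_cartesian_product power2_eq_square)
  finally show ?thesis .
qed

lemma card_consecutive_sums_collisions_le:
  fixes A :: "'a::ab_group_add set"
  assumes "finite A" "X \<subseteq> A \<times> A \<times> A"
  shows "card (collisions (\<lambda>(a, b, c). (a + b, b + c)) X) \<le> additive_energy 3 A A"
proof -
  let ?sums = "\<lambda>(a, b, c). (a + b, b + c) :: 'a \<times> 'a"
  let ?sextuple = "\<lambda>(x, a', b, c'). ((a' - x, b, c' - x), (a', b - x, c'))"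
  let ?F = "diff_fiber A A"
  have "collisions ?sums X \<subseteq> ?sextuple ` (SIGMA x:diff_set A A. ?F x \<times> ?F x \<times> ?F x)"
  proof
    fix q assume "q \<in> collisions ?sums X"
    then obtain a b c a' b' c' where q_eq: "q = ((a, b, c), (a', b', c'))"
      and in_X: "(a, b, c) \<in> X" "(a', b', c') \<in> X"
      and same_sums: "a + b = a' + b'" "b + c = b' + c'"
      by (auto simp: collisions_def)
    obtain x where a'_eq: "a' = a + x" by (metis diff_add_cancel add.commute)
    then have b_eq: "b = b' + x" using same_sums(1) by (simp add: add_ac)
    then have c'_eq: "c' = c + x" using same_sums(2) by (simp add: add_ac)
    have "a' \<in> ?F x" "b \<in> ?F x" "c' \<in> ?F x"
      using in_X assms(2) by (auto simp: diff_fiber_def a'_eq b_eq c'_eq)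
    then show "q \<in> ?sextuple ` (SIGMA x:diff_set A A. ?F x \<times> ?F x \<times> ?F x)"
      using diff_fiber_imp_diff_set[of a' A A x]
      by (intro image_eqI[of _ _ "(x, a', b, c')"]) (auto simp: q_eq a'_eq b_eq c'_eq)
  qed
  then have "card (collisions ?sums X) \<le> card (SIGMA x:diff_set A A. ?F x \<times> ?F x \<times> ?F x)"
    by (rule surj_card_le[rotated]) (use assms in auto)
  also have "\<dots> = additive_energy 3 A A"
    using assms
    by (simp add: additive_energy_def diff_reps_def card_cartesian_product power3_eq_cube
        mult.assoc)
  finally show ?thesis .
qed

lemma card_squared_le_card_sumset_mult_energy:
  fixes A B :: "'a::ab_group_add set"
  assumes "finite A" "finite B"
  shows "(card A * card B)\<^sup>2 \<le> card (A + B) * additive_energy 2 A B"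
proof -
  let ?add = "\<lambda>(a, b). a + b :: 'a"
  have "(card A * card B)\<^sup>2 = (card (A \<times> B))\<^sup>2" by (simp add: card_cartesian_product)
  also have "\<dots> \<le> card (?add ` (A \<times> B)) * card (collisions ?add (A \<times> B))"
    by (rule card_squared_le_card_image_mult_collisions) (use assms in auto)
  also have "?add ` (A \<times> B) = A + B" by (simp add: set_plus_image case_prod_unfold)
  also have "card (A + B) * card (collisions ?add (A \<times> B))
      \<le> card (A + B) * additive_energy 2 A B"
    by (rule mult_le_mono2[OF card_sum_collisions_le[OF assms]])
  finally show ?thesis .
qed

lemma card_power4_le_energy_of_half:
  fixes A :: "'a::ab_group_add set"
  assumes "finite A" "A' \<subseteq> A" and half: "card A \<le> 2 * card A'"
  shows "card A ^ 4 \<le> 16 * card (A + A) * additive_energy 2 A' A'"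
proof -
  have "finite A'" using assms by (auto intro: finite_subset)
  have "card A ^ 4 \<le> (2 * card A') ^ 4" using half by (rule power_mono) simp
  also have "\<dots> = 16 * (card A' * card A')\<^sup>2" by (simp add: power4_eq_xxxx power2_eq_square)
  also have "\<dots> \<le> 16 * (card (A' + A') * additive_energy 2 A' A')"
    using card_squared_le_card_sumset_mult_energy[of A' A'] \<open>finite A'\<close> by simp
  also have "\<dots> \<le> 16 * (card (A + A) * additive_energy 2 A' A')"
    using assms by (intro mult_le_mono2 mult_le_mono1 card_mono set_plus_mono2 finite_set_plus)
  finally show ?thesis by simp
qed

lemma sum_diff_reps_mult_power6_le:
  fixes A B C X :: "'a::ab_group_add set"
  assumes fin: "finite A" "finite B" "finite C" "finite X"
  shows "(\<Sum>x\<in>X. diff_reps A B x * diff_reps C A x) ^ 6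
    \<le> (card A * card B) ^ 3 * additive_energy 3 A B * (additive_energy 3 A C)\<^sup>2"
proof -
  have "real ((\<Sum>x\<in>X. diff_reps A B x * diff_reps C A x) ^ 6)
      \<le> (\<Sum>x\<in>X. real (diff_reps A B x)) ^ 3 * (\<Sum>x\<in>X. real (diff_reps A B x) ^ 3) *
        (\<Sum>x\<in>X. real (diff_reps C A x) ^ 3)\<^sup>2"
    using sum_mult_power6_le[of X "\<lambda>x. real (diff_reps A B x)" "\<lambda>x. real (diff_reps C A x)"] by simp
  also have "\<dots> = real ((\<Sum>x\<in>X. diff_reps A B x ^ 1) ^ 3 * (\<Sum>x\<in>X. diff_reps A B x ^ 3) *
      (\<Sum>x\<in>X. diff_reps C A x ^ 3)\<^sup>2)" by simp
  finally have "(\<Sum>x\<in>X. diff_reps A B x * diff_reps C A x) ^ 6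
      \<le> (\<Sum>x\<in>X. diff_reps A B x ^ 1) ^ 3 * (\<Sum>x\<in>X. diff_reps A B x ^ 3) *
        (\<Sum>x\<in>X. diff_reps C A x ^ 3)\<^sup>2"
    by (simp only: of_nat_le_iff)
  also have "\<dots> \<le> additive_energy 1 A B ^ 3 * additive_energy 3 A B * (additive_energy 3 C A)\<^sup>2"
    by (intro mult_le_mono power_mono sum_diff_reps_power_le_additive_energy) (use fin in auto)
  finally show ?thesis
    by (simp only: additive_energy_1[OF fin(1,2)] additive_energy_commute[of 3 C A])
qed


section \<open>Sets with few popular differences\<close>

definition Szemeredi_Trotter_set :: "'a::ab_group_add set \<Rightarrow> real \<Rightarrow> bool" where
  "Szemeredi_Trotter_set A K \<longleftrightarrow>
    (\<forall>B t. finite B \<longrightarrow> t > 0 \<longrightarrow>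
      card (popular_diffs A B t) * real t ^ 3 \<le> K * (real (card B))\<^sup>2)"

lemma Szemeredi_Trotter_setD:
  assumes "Szemeredi_Trotter_set A K" "finite B" "t > 0"
  shows "card (popular_diffs A B t) * real t ^ 3 \<le> K * (real (card B))\<^sup>2"
  using assms unfolding Szemeredi_Trotter_set_def by blast

lemma Szemeredi_Trotter_set_nonneg: "Szemeredi_Trotter_set A K \<Longrightarrow> K \<ge> 0"
  using Szemeredi_Trotter_setD[of A K "{0}" 1] order_trans[OF of_nat_0_le_iff] by fastforce

lemma Szemeredi_Trotter_set_subset:
  assumes "Szemeredi_Trotter_set A K" "finite A" "A' \<subseteq> A"
  shows "Szemeredi_Trotter_set A' K"
  unfolding Szemeredi_Trotter_set_def
proof (intro allI impI)
  fix B :: "'a set" and t :: nat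
  assume "finite B" "t > 0"
  have "popular_diffs A' B t \<subseteq> popular_diffs A B t"
    using diff_reps_mono[OF assms(2,3) order_refl]
    by (auto simp: popular_diffs_def intro: order_trans)
  then have "card (popular_diffs A' B t) \<le> card (popular_diffs A B t)"
    using assms(2) \<open>finite B\<close> \<open>t > 0\<close> by (intro card_mono finite_popular_diffs)
  then have "card (popular_diffs A' B t) * real t ^ 3 \<le> card (popular_diffs A B t) * real t ^ 3"
    by (intro mult_right_mono) auto
  also have "\<dots> \<le> K * (real (card B))\<^sup>2"
    by (rule Szemeredi_Trotter_setD[OF assms(1) \<open>finite B\<close> \<open>t > 0\<close>])
  finally show "card (popular_diffs A' B t) * real t ^ 3 \<le> K * (real (card B))\<^sup>2" .
qed

lemma Szemeredi_Trotter_set_additive_energy_3_le: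
  assumes "Szemeredi_Trotter_set A K" "finite A" "finite B"
  shows "additive_energy 3 A B \<le> 3 * K * (real (card B))\<^sup>2 * harm (card A)"
  using additive_energy_le_harm[of A B 3, OF _ _ _ Szemeredi_Trotter_setD[OF assms(1,3)]] assms
  by (simp add: mult.assoc)

lemma ratio_reps_le_card:
  assumes "finite Y" "0 \<notin> Y"
  shows "ratio_reps X Y x \<le> card Y"
  unfolding ratio_reps_def
proof (rule card_inj_on_le)
  show "inj_on snd {(u, v) \<in> X \<times> Y. x = u / v}"
    using assms(2) by (auto simp: inj_on_def field_simps)
qed (use assms in auto)

lemma le_card_if_ratio_reps_ge:
  fixes T :: real
  assumes "finite P" "0 \<notin> P" "A \<noteq> {}" "\<And>a. a \<in> A \<Longrightarrow> real (ratio_reps P P a) \<ge> T"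
  shows "T \<le> card P"
proof -
  obtain a where "a \<in> A" using assms(3) by blast
  then have "T \<le> ratio_reps P P a" by (rule assms(4))
  also have "\<dots> \<le> card P" using ratio_reps_le_card[OF assms(1,2)] by simp
  finally show ?thesis .
qed

lemma popular_diffs_nonempty_bounds:
  fixes A B P :: "real set" and T :: real
  assumes "finite A" "finite B" "finite P" "0 \<notin> P"
    and "\<And>a. a \<in> A \<Longrightarrow> real (ratio_reps P P a) \<ge> T"
    and "t > 0" "popular_diffs A B t \<noteq> {}"
  shows "t \<le> card A" "t \<le> card B" "T \<le> card P"
proof -
  obtain x where popular: "t \<le> diff_reps A B x" using assms(7) by (auto simp: popular_diffs_def)
  show "t \<le> card A" "t \<le> card B"
    using popular diff_reps_le_card_left[OF assms(1)] diff_reps_le_card_right[OF assms(2)]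
    by (meson order_trans)+
  then have "A \<noteq> {}" using \<open>t > 0\<close> by auto
  then show "T \<le> card P" using le_card_if_ratio_reps_ge assms by metis
qed

lemma popular_diffs_incidences_ge:
  fixes A B D P :: "real set" and T :: real
  assumes fin: "finite A" "finite B" "finite P" "finite D"
    and reps: "\<And>a. a \<in> A \<Longrightarrow> real (ratio_reps P P a) \<ge> T" and T: "T \<ge> 0"
    and D: "D \<subseteq> popular_diffs A B t"
  shows "real (card D) * t * T \<le> incidences (D \<times> inverse ` P) (P \<times> B)"
proof -
  define R where "R a = {(u, v) \<in> P \<times> P. a = u / v}" for a
  define Z where "Z = (SIGMA (p, b):P \<times> B. (D \<times> inverse ` P) \<inter> line p b)"
  let ?g = "\<lambda>(x, a, p, q). ((p, a - x), (x, inverse q))"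
  have finite_R: "finite (R a)" for a
    by (rule finite_subset[of _ "P \<times> P"]) (use fin in \<open>auto simp: R_def\<close>)
  have "real (card D) * t * T = (\<Sum>x\<in>D. t * T)" by simp
  also have "\<dots> \<le> (\<Sum>x\<in>D. \<Sum>a\<in>diff_fiber A B x. real (card (R a)))"
  proof (rule sum_mono)
    fix x assume "x \<in> D"
    then have "t * T \<le> diff_reps A B x * T"
      using D T by (intro mult_right_mono) (auto simp: popular_diffs_def)
    also have "\<dots> = (\<Sum>a\<in>diff_fiber A B x. T)" by (simp add: diff_reps_def)
    also have "\<dots> \<le> (\<Sum>a\<in>diff_fiber A B x. real (card (R a)))"
      by (rule sum_mono) (use reps in \<open>auto simp: R_def ratio_reps_def diff_fiber_def\<close>)
    finally show "t * T \<le> (\<Sum>a\<in>diff_fiber A B x. real (card (R a)))" .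
  qed
  also have "\<dots> = real (card (SIGMA x:D. SIGMA a:diff_fiber A B x. R a))"
    using fin finite_R by simp
  also have "card (SIGMA x:D. SIGMA a:diff_fiber A B x. R a) \<le> card Z"
  proof (rule card_inj_on_le)
    show "inj_on ?g (SIGMA x:D. SIGMA a:diff_fiber A B x. R a)" by (auto simp: inj_on_def)
    show "?g ` (SIGMA x:D. SIGMA a:diff_fiber A B x. R a) \<subseteq> Z"
      by (auto simp: Z_def R_def diff_fiber_def line_def divide_inverse)
    show "finite Z"
      unfolding Z_def using fin by (intro finite_SigmaI) (auto split: prod.split)
  qed
  also have "card Z = incidences (D \<times> inverse ` P) (P \<times> B)"
    unfolding Z_def using fin by (intro incidences_eq_card_Sigma[symmetric]) auto
  finally show ?thesis by simp
qed

lemma popular_diffs_ratio_dichotomy: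
  fixes A B D P :: "real set" and T :: real
  assumes fin: "finite A" "finite B" "finite P" "finite D" and "0 \<notin> P"
    and reps: "\<And>a. a \<in> A \<Longrightarrow> real (ratio_reps P P a) \<ge> T" and T: "T \<ge> 0"
    and D: "D \<subseteq> popular_diffs A B t"
  shows "real (card D) * t * T \<le> 4 * (real (card P) * card B) \<or>
    (real (card D) * t * T) ^ 3 \<le> 512 * (real (card D) * card P * (real (card P) * card B))\<^sup>2"
proof -
  define I where "I = incidences (D \<times> inverse ` P) (P \<times> B)"
  have I_ge: "real (card D) * t * T \<le> I"
    unfolding I_def by (rule popular_diffs_incidences_ge[OF fin reps T D])
  show ?thesis
  proof (cases "4 * card (P \<times> B) < I")
    case True
    have "I ^ 3 \<le> 512 * (card D * card (inverse ` P) * card (P \<times> B))\<^sup>2"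
      unfolding I_def
      by (rule Szemeredi_Trotter_grid) (use True fin \<open>0 \<notin> P\<close> in \<open>auto simp: I_def\<close>)
    also have "\<dots> = 512 * (card D * card P * (card P * card B))\<^sup>2"
      by (simp add: card_image inj_on_def card_cartesian_product)
    finally have "real (I ^ 3) \<le> real (512 * (card D * card P * (card P * card B))\<^sup>2)"
      by (rule of_nat_mono)
    moreover have "(real (card D) * t * T) ^ 3 \<le> real (I ^ 3)"
      unfolding of_nat_power using I_ge T by (intro power_mono) auto
    ultimately show ?thesis by simp
  next
    case False
    then have "real I \<le> real (4 * card (P \<times> B))" by (intro of_nat_mono) simp
    then show ?thesis using I_ge by (simp add: card_cartesian_product)
  qed
qed

lemma card_popular_diffs_mult_cube_le:
  fixes A B P :: "real set" and T :: real
  assumes fin: "finite A" "finite B" "finite P" and P: "0 \<notin> P" "card A \<le> card P"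
    and T: "T > 0" and reps: "\<And>a. a \<in> A \<Longrightarrow> real (ratio_reps P P a) \<ge> T"
    and t: "t > 0" and nonempty: "popular_diffs A B t \<noteq> {}"
  shows "real (card (popular_diffs A B t)) * (t * T) ^ 3
    \<le> 512 * real (card P) ^ 4 * (real (card B))\<^sup>2"
proof -
  define d \<pi> \<beta> where "d = real (card (popular_diffs A B t))"
    and "\<pi> = real (card P)" and "\<beta> = real (card B)"
  have finite_D: "finite (popular_diffs A B t)" using fin t by (intro finite_popular_diffs)
  then have "d > 0" using nonempty by (simp add: d_def card_gt_0_iff)
  consider (few) "d * t * T \<le> 4 * (\<pi> * \<beta>)" | (many) "(d * t * T) ^ 3 \<le> 512 * (d * \<pi> * (\<pi> * \<beta>))\<^sup>2"
    using popular_diffs_ratio_dichotomy[OF fin finite_D P(1) reps] T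
    unfolding d_def \<pi>_def \<beta>_def by fastforce
  then have "d * (t * T) ^ 3 \<le> 512 * \<pi> ^ 4 * \<beta>\<^sup>2"
  proof cases
    case few
    have "t \<le> \<pi>" "t \<le> \<beta>" "T \<le> \<pi>"
      using popular_diffs_nonempty_bounds[OF fin P(1) reps t nonempty] P(2)
      by (auto simp: \<pi>_def \<beta>_def)
    then have "(T * T) * (real t * real t) \<le> (\<pi> * \<pi>) * (\<pi> * \<beta>)"
      using T by (intro mult_mono) auto
    then have "(d * t * T) * ((T * T) * (real t * real t)) \<le> (4 * (\<pi> * \<beta>)) * ((\<pi> * \<pi>) * (\<pi> * \<beta>))"
      by (rule mult_mono[OF few]) (use T in \<open>auto simp: \<pi>_def \<beta>_def\<close>)
    also have "\<dots> \<le> 512 * \<pi> ^ 4 * \<beta>\<^sup>2"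
      by (simp add: power2_eq_square power4_eq_xxxx mult_ac \<pi>_def \<beta>_def)
    finally show ?thesis by (simp add: power3_eq_cube mult_ac)
  next
    case many
    moreover have "(d * t * T) ^ 3 = d\<^sup>2 * (d * (t * T) ^ 3)"
      and "512 * (d * \<pi> * (\<pi> * \<beta>))\<^sup>2 = d\<^sup>2 * (512 * \<pi> ^ 4 * \<beta>\<^sup>2)"
      by algebra+
    ultimately show ?thesis using \<open>d > 0\<close> by (simp only: mult_le_cancel_left_pos zero_less_power)
  qed
  then show ?thesis by (simp add: d_def \<pi>_def \<beta>_def)
qed

lemma Szemeredi_Trotter_set_if_ratio_reps_ge:
  fixes A P :: "real set" and T :: real
  assumes fin: "finite A" "finite P" and P: "0 \<notin> P" "card A \<le> card P"
    and T: "T > 0" and reps: "\<And>a. a \<in> A \<Longrightarrow> real (ratio_reps P P a) \<ge> T"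
  shows "Szemeredi_Trotter_set A (512 * real (card P) ^ 4 / T ^ 3)"
  unfolding Szemeredi_Trotter_set_def
proof (intro allI impI)
  fix B :: "real set" and t :: nat
  assume B: "finite B" and t: "t > 0"
  show "card (popular_diffs A B t) * real t ^ 3
      \<le> 512 * real (card P) ^ 4 / T ^ 3 * (real (card B))\<^sup>2"
  proof (cases "popular_diffs A B t = {}")
    case False
    then show ?thesis
      using card_popular_diffs_mult_cube_le[OF fin(1) B fin(2) P T reps t] T
      by (simp add: field_simps)
  qed (use T in simp)
qed


section \<open>Popular sums\<close>

lemma exists_subset_many_common_neighbours:
  assumes fin: "finite A" "finite B"
    and nonedges: "6 * card {(a, b) \<in> A \<times> B. \<not> E a b} \<le> card A * card B"
  obtains A' where "A' \<subseteq> A" "card A \<le> 2 * card A'"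
    "\<And>a c. a \<in> A' \<Longrightarrow> c \<in> A' \<Longrightarrow> card B \<le> 3 * card {b\<in>B. E a b \<and> E c b}"
proof
  define N where "N a = {b\<in>B. \<not> E a b}" for a
  define A' where "A' = {a\<in>A. 3 * card (N a) \<le> card B}"
  show "A' \<subseteq> A" by (auto simp: A'_def)
  have finite_N: "finite (N a)" for a using fin by (simp add: N_def)
  have "{(a, b) \<in> A \<times> B. \<not> E a b} = (SIGMA a:A. N a)" by (auto simp: N_def)
  then have card_nonedges: "card {(a, b) \<in> A \<times> B. \<not> E a b} = (\<Sum>a\<in>A. card (N a))"
    using fin finite_N by simp
  have "card (A - A') * card B = (\<Sum>a\<in>A - A'. card B)" by simp
  also have "\<dots> \<le> (\<Sum>a\<in>A - A'. 3 * card (N a))" by (rule sum_mono) (auto simp: A'_def)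
  also have "\<dots> \<le> (\<Sum>a\<in>A. 3 * card (N a))" by (rule sum_mono2) (use fin in auto)
  also have "\<dots> = 3 * card {(a, b) \<in> A \<times> B. \<not> E a b}"
    unfolding card_nonedges by (rule sum_distrib_left[symmetric])
  finally have "2 * card (A - A') * card B \<le> card A * card B" using nonedges by linarith
  moreover have "card (A - A') = 0" if "card B = 0"
    using that fin by (auto simp: A'_def N_def)
  ultimately have "2 * card (A - A') \<le> card A" by (cases "card B = 0") auto
  moreover have "card (A - A') = card A - card A'"
    using fin \<open>A' \<subseteq> A\<close> by (intro card_Diff_subset) (auto intro: finite_subset)
  ultimately show "card A \<le> 2 * card A'" by linarith
  fix a c assume "a \<in> A'" "c \<in> A'"
  let ?G = "{b\<in>B. E a b \<and> E c b}"
  have "card B \<le> card (?G \<union> (N a \<union> N c))"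
    using fin finite_N by (intro card_mono) (auto simp: N_def)
  also have "\<dots> \<le> card ?G + (card (N a) + card (N c))"
    by (meson card_Un_le add_left_mono order_trans)
  finally show "card B \<le> 3 * card ?G" using \<open>a \<in> A'\<close> \<open>c \<in> A'\<close> by (auto simp: A'_def)
qed

definition sum_reps :: "'a::ab_group_add set \<Rightarrow> 'a \<Rightarrow> nat" where
  "sum_reps A x = card {a\<in>A. x - a \<in> A}"

definition popular_sums :: "'a::ab_group_add set \<Rightarrow> 'a set" where
  "popular_sums A = {x \<in> A + A. (card A)\<^sup>2 \<le> 6 * card (A + A) * sum_reps A x}"

definition popular_core :: "'a::ab_group_add set \<Rightarrow> 'a set \<Rightarrow> bool" where
  "popular_core A A' \<longleftrightarrow> A' \<subseteq> A \<and> (\<forall>a\<in>A'. \<forall>c\<in>A'.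
    card A \<le> 3 * card {b\<in>A. a + b \<in> popular_sums A \<and> b + c \<in> popular_sums A})"

lemma popular_sums_subset: "popular_sums A \<subseteq> A + A"
  by (auto simp: popular_sums_def)

lemma finite_popular_sums: "finite A \<Longrightarrow> finite (popular_sums A)"
  by (rule finite_subset[OF popular_sums_subset finite_set_plus])

lemma card_unpopular_pairs_le:
  fixes A :: "'a::ab_group_add set"
  assumes "finite A"
  shows "6 * card {(a, b) \<in> A \<times> A. a + b \<notin> popular_sums A} \<le> (card A)\<^sup>2"
proof (cases "A = {}")
  case False
  define s U where "s = card (A + A)" and "U = (A + A) - popular_sums A"
  have finite_sumset: "finite (A + A)" using assms by (simp add: finite_set_plus)
  have "s > 0" using False finite_sumset by (auto simp: s_def card_gt_0_iff set_plus_def)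
  define F where "F x = {a\<in>A. x - a \<in> A}" for x
  have finite_F: "finite (SIGMA x:U. F x)"
    using assms finite_sumset by (simp add: U_def F_def)
  have "{(a, b) \<in> A \<times> A. a + b \<notin> popular_sums A} \<subseteq> (\<lambda>(x, a). (a, x - a)) ` (SIGMA x:U. F x)"
  proof (clarify, rule image_eqI)
    fix a b assume "a \<in> A" "b \<in> A" "a + b \<notin> popular_sums A"
    then show "(a + b, a) \<in> (SIGMA x:U. F x)" by (auto simp: U_def F_def set_plus_intro)
  qed simp
  then have "card {(a, b) \<in> A \<times> A. a + b \<notin> popular_sums A} \<le> card (SIGMA x:U. F x)"
    by (rule surj_card_le[OF finite_F])
  also have "\<dots> = (\<Sum>x\<in>U. sum_reps A x)"
    using assms finite_sumset by (simp add: U_def F_def sum_reps_def)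
  finally have "6 * s * card {(a, b) \<in> A \<times> A. a + b \<notin> popular_sums A}
      \<le> (\<Sum>x\<in>U. 6 * s * sum_reps A x)"
    by (simp flip: sum_distrib_left)
  also have "\<dots> \<le> (\<Sum>x\<in>U. (card A)\<^sup>2)"
    by (rule sum_mono) (auto simp: U_def popular_sums_def s_def)
  also have "\<dots> \<le> s * (card A)\<^sup>2"
    using finite_sumset by (auto simp: U_def s_def intro!: mult_le_mono1 card_mono)
  finally show ?thesis using \<open>s > 0\<close> by simp
qed simp

lemma exists_popular_core:
  fixes A :: "'a::ab_group_add set"
  assumes "finite A"
  obtains A' where "popular_core A A'" "card A \<le> 2 * card A'"
proof -
  have "6 * card {(a, b) \<in> A \<times> A. \<not> a + b \<in> popular_sums A} \<le> card A * card A"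
    using card_unpopular_pairs_le[OF assms] by (simp add: power2_eq_square)
  then show thesis
  proof (rule exists_subset_many_common_neighbours[OF assms assms])
    fix A' assume "A' \<subseteq> A" and half: "card A \<le> 2 * card A'"
      and "\<And>a c. a \<in> A' \<Longrightarrow> c \<in> A' \<Longrightarrow>
        card A \<le> 3 * card {b\<in>A. a + b \<in> popular_sums A \<and> c + b \<in> popular_sums A}"
    then have "popular_core A A'" by (simp add: popular_core_def add.commute)
    then show thesis using half by (rule that)
  qed
qed

definition popular_triples :: "'a::ab_group_add set \<Rightarrow> 'a set \<Rightarrow> 'a set \<Rightarrow> ('a \<times> 'a \<times> 'a) set" where
  "popular_triples A A' P = {(a, b, c) \<in> A' \<times> A \<times> A'.
    a - c \<in> P \<and> a + b \<in> popular_sums A \<and> b + c \<in> popular_sums A}"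

definition popular_sum_pairs :: "'a::ab_group_add set \<Rightarrow> 'a set \<Rightarrow> ('a \<times> 'a) set" where
  "popular_sum_pairs A P = {(x, y) \<in> popular_sums A \<times> popular_sums A. x - y \<in> P}"

lemma finite_popular_sum_pairs: "finite A \<Longrightarrow> finite (popular_sum_pairs A P)"
  unfolding popular_sum_pairs_def
  by (rule finite_subset[of _ "popular_sums A \<times> popular_sums A"]) (auto simp: finite_popular_sums)

lemma finite_popular_triples: "finite A \<Longrightarrow> A' \<subseteq> A \<Longrightarrow> finite (popular_triples A A' P)"
  unfolding popular_triples_def
  by (rule finite_subset[of _ "A \<times> A \<times> A"]) auto

lemma card_popular_triples_ge:
  fixes A A' P :: "'a::ab_group_add set"
  assumes fin: "finite A" "finite P" and core: "popular_core A A'"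
    and P: "P \<subseteq> popular_diffs A' A' t"
  shows "card P * t * card A \<le> 3 * card (popular_triples A A' P)"
proof -
  let ?F = "diff_fiber A' A'"
  let ?G = "\<lambda>a c. {b\<in>A. a + b \<in> popular_sums A \<and> b + c \<in> popular_sums A}"
  have "A' \<subseteq> A" using core by (simp add: popular_core_def)
  then have finite_A': "finite A'" using fin finite_subset by blast
  have "card P * t * card A = (\<Sum>x\<in>P. t * card A)" by simp
  also have "\<dots> \<le> (\<Sum>x\<in>P. \<Sum>a\<in>?F x. 3 * card (?G a (a - x)))"
  proof (rule sum_mono)
    fix x assume "x \<in> P"
    then have "t * card A \<le> (\<Sum>a\<in>?F x. card A)"
      using P by (auto simp: popular_diffs_def diff_reps_def)
    also have "\<dots> \<le> (\<Sum>a\<in>?F x. 3 * card (?G a (a - x)))"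
      by (rule sum_mono) (use core in \<open>auto simp: popular_core_def diff_fiber_def\<close>)
    finally show "t * card A \<le> (\<Sum>a\<in>?F x. 3 * card (?G a (a - x)))" .
  qed
  also have "\<dots> = 3 * card (SIGMA x:P. SIGMA a:?F x. ?G a (a - x))"
    using fin finite_A' by (simp add: sum_distrib_left)
  also have "card (SIGMA x:P. SIGMA a:?F x. ?G a (a - x)) \<le> card (popular_triples A A' P)"
    by (rule card_inj_on_le[of "\<lambda>(x, a, b). (a, b, a - x)"])
      (use finite_popular_triples[OF fin(1) \<open>A' \<subseteq> A\<close>] in
        \<open>auto simp: inj_on_def popular_triples_def diff_fiber_def\<close>)
  finally show ?thesis by simp
qed

lemma card_popular_triples_squared_le:
  fixes A A' P :: "'a::ab_group_add set"
  assumes "finite A" "A' \<subseteq> A"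
  shows "(card (popular_triples A A' P))\<^sup>2 \<le> card (popular_sum_pairs A P) * additive_energy 3 A A"
proof -
  let ?R = "popular_triples A A' P"
  let ?f = "\<lambda>(a, b, c). (a + b, b + c)"
  have "(card ?R)\<^sup>2 \<le> card (?f ` ?R) * card (collisions ?f ?R)"
    by (rule card_squared_le_card_image_mult_collisions[OF finite_popular_triples[OF assms]])
  also have "\<dots> \<le> card (popular_sum_pairs A P) * additive_energy 3 A A"
  proof (rule mult_le_mono)
    show "card (?f ` ?R) \<le> card (popular_sum_pairs A P)"
      by (rule card_mono[OF finite_popular_sum_pairs[OF assms(1)]])
        (auto simp: popular_triples_def popular_sum_pairs_def)
    show "card (collisions ?f ?R) \<le> additive_energy 3 A A"
      by (rule card_consecutive_sums_collisions_le)
        (use assms in \<open>auto simp: popular_triples_def\<close>)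
  qed
  finally show ?thesis .
qed

text \<open>Writing \<open>x = a + a'\<close>, the pair gives \<open>a - (x - y) = y - a'\<close>, a common value of two
  differences.\<close>

lemma card_popular_sum_pairs_le:
  fixes A P :: "'a::ab_group_add set"
  assumes "finite A"
  shows "(card A)\<^sup>2 * card (popular_sum_pairs A P)
    \<le> 6 * card (A + A) * (\<Sum>z\<in>diff_set (A + A) A. diff_reps A P z * diff_reps (A + A) A z)"
proof -
  let ?Q = "popular_sum_pairs A P"
  let ?F = "\<lambda>x. {a\<in>A. x - a \<in> A}"
  let ?H = "\<lambda>z. diff_fiber A P z \<times> diff_fiber (A + A) A z"
  have finite_sumset: "finite (A + A)" using assms by (simp add: finite_set_plus)
  have "(card A)\<^sup>2 * card ?Q = (\<Sum>q\<in>?Q. (card A)\<^sup>2)" by simp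
  also have "\<dots> \<le> (\<Sum>q\<in>?Q. 6 * card (A + A) * sum_reps A (fst q))"
    by (rule sum_mono) (auto simp: popular_sum_pairs_def popular_sums_def)
  also have "\<dots> = 6 * card (A + A) * card (SIGMA q:?Q. ?F (fst q))"
    using assms finite_popular_sum_pairs[OF assms]
    by (simp add: sum_reps_def flip: sum_distrib_left)
  also have "card (SIGMA q:?Q. ?F (fst q)) \<le> card (SIGMA z:diff_set (A + A) A. ?H z)"
  proof (rule card_inj_on_le)
    let ?g = "\<lambda>((x, y), a). (y - (x - a), a, y)"
    show "inj_on ?g (SIGMA q:?Q. ?F (fst q))" by (auto simp: inj_on_def)
    show "?g ` (SIGMA q:?Q. ?F (fst q)) \<subseteq> (SIGMA z:diff_set (A + A) A. ?H z)"
    proof (rule image_subsetI)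
      fix w assume "w \<in> (SIGMA q:?Q. ?F (fst q))"
      then obtain x y a where w_eq: "w = ((x, y), a)" and in_A: "a \<in> A" "x - a \<in> A"
        and y: "y \<in> popular_sums A" and P: "x - y \<in> P"
        by (auto simp: popular_sum_pairs_def)
      define z where "z = y - (x - a)"
      have "a - z = x - y" "y - z = x - a" by (auto simp: z_def)
      then have "a \<in> diff_fiber A P z" "y \<in> diff_fiber (A + A) A z"
        using in_A subsetD[OF popular_sums_subset y] P by (auto simp: diff_fiber_def)
      then show "?g w \<in> (SIGMA z:diff_set (A + A) A. ?H z)"
        using diff_fiber_imp_diff_set[of y "A + A" A z] by (simp add: w_eq z_def)
    qed
  qed (use assms finite_sumset in simp)
  also have "\<dots> = (\<Sum>z\<in>diff_set (A + A) A. diff_reps A P z * diff_reps (A + A) A z)"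
    using assms finite_sumset by (simp add: diff_reps_def card_cartesian_product)
  finally show ?thesis by simp
qed

lemma popular_diffs_additive_energy_bound:
  fixes A A' P :: "'a::ab_group_add set"
  assumes fin: "finite A" "finite P" and core: "popular_core A A'"
    and P: "P \<subseteq> popular_diffs A' A' t"
  shows "(card P * t * (card A)\<^sup>2) ^ 12 \<le> (54 * card (A + A) * additive_energy 3 A A) ^ 6 *
    ((card A * card P) ^ 3 * additive_energy 3 A P * (additive_energy 3 A (A + A))\<^sup>2)"
proof -
  define n s E where "n = card A" and "s = card (A + A)" and "E = additive_energy 3 A A"
  define R Q where "R = card (popular_triples A A' P)" and "Q = card (popular_sum_pairs A P)"
  define W where "W = (\<Sum>z\<in>diff_set (A + A) A. diff_reps A P z * diff_reps (A + A) A z)"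
  have finite_sumset: "finite (A + A)" using fin by (simp add: finite_set_plus)
  have triples_ge: "card P * t * n \<le> 3 * R"
    unfolding n_def R_def by (rule card_popular_triples_ge[OF fin core P])
  have triples_le: "R\<^sup>2 \<le> Q * E"
    unfolding R_def Q_def E_def using fin core
    by (intro card_popular_triples_squared_le) (auto simp: popular_core_def)
  have pairs_le: "n\<^sup>2 * Q \<le> 6 * s * W"
    unfolding n_def Q_def s_def W_def by (rule card_popular_sum_pairs_le[OF fin(1)])
  have "(card P * t * n\<^sup>2)\<^sup>2 = n\<^sup>2 * (card P * t * n)\<^sup>2" by (simp add: power2_eq_square mult_ac)
  also have "\<dots> \<le> n\<^sup>2 * (3 * R)\<^sup>2" using triples_ge by (intro mult_le_mono2 power_mono) auto
  also have "\<dots> = 9 * n\<^sup>2 * R\<^sup>2" by (simp add: power_mult_distrib)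
  also have "\<dots> \<le> 9 * n\<^sup>2 * (Q * E)" using triples_le by (rule mult_le_mono2)
  also have "\<dots> = 9 * E * (n\<^sup>2 * Q)" by simp
  also have "\<dots> \<le> 9 * E * (6 * s * W)" using pairs_le by (rule mult_le_mono2)
  finally have "((card P * t * n\<^sup>2)\<^sup>2) ^ 6 \<le> (54 * s * E * W) ^ 6"
    by (intro power_mono) (auto simp: mult_ac)
  also have "\<dots> = (54 * s * E) ^ 6 * W ^ 6" by (rule power_mult_distrib)
  also have "\<dots> \<le> (54 * s * E) ^ 6 *
      ((card A * card P) ^ 3 * additive_energy 3 A P * (additive_energy 3 A (A + A))\<^sup>2)"
    unfolding W_def using fin finite_sumset
    by (intro mult_le_mono2 sum_diff_reps_mult_power6_le) auto
  finally show ?thesis by (simp add: n_def s_def E_def flip: power_mult)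
qed


section \<open>The sumset bound\<close>

lemma card_popular_diffs_core_power7_le:
  fixes A A' :: "'a::ab_group_add set"
  assumes K: "Szemeredi_Trotter_set A K" and fin: "finite A" and "A \<noteq> {}"
    and core: "popular_core A A'" and t: "t > 0"
  shows "real (card (popular_diffs A' A' t)) ^ 7 * real t ^ 12 * real (card A) ^ 9
    \<le> 54 ^ 6 * 3 ^ 9 * real (card (A + A)) ^ 10 * K ^ 9 * harm (card A) ^ 9"
proof -
  define P where "P = popular_diffs A' A' t"
  define n s m h where "n = real (card A)" and "s = real (card (A + A))"
    and "m = real (card P)" and "h = (harm (card A) :: real)"
  have "finite A'" using core fin by (auto simp: popular_core_def intro: finite_subset)
  then have finite_P: "finite P" unfolding P_def using t by (intro finite_popular_diffs)
  have "n > 0" using \<open>A \<noteq> {}\<close> fin by (simp add: n_def card_gt_0_iff)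
  have nonneg: "K \<ge> 0" "h \<ge> 0" "s \<ge> 0" "m \<ge> 0"
    using Szemeredi_Trotter_set_nonneg[OF K] by (auto simp: h_def s_def m_def harm_nonneg)
  have energy: "additive_energy 3 A B \<le> 3 * K * (real (card B))\<^sup>2 * h" if "finite B" for B
    unfolding h_def by (rule Szemeredi_Trotter_set_additive_energy_3_le[OF K fin that])
  have "m ^ 7 * real t ^ 12 * n ^ 9 \<le> 54 ^ 6 * 3 ^ 9 * s ^ 10 * K ^ 9 * h ^ 9"
  proof (cases "m = 0")
    case False
    have "real ((card P * t * (card A)\<^sup>2) ^ 12)
      \<le> real ((54 * card (A + A) * additive_energy 3 A A) ^ 6 *
        ((card A * card P) ^ 3 * additive_energy 3 A P * (additive_energy 3 A (A + A))\<^sup>2))"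
      by (intro of_nat_mono popular_diffs_additive_energy_bound[OF fin finite_P core])
        (simp add: P_def)
    then have "(m * t * n\<^sup>2) ^ 12 \<le> (54 * s * additive_energy 3 A A) ^ 6 *
        ((n * m) ^ 3 * additive_energy 3 A P * (real (additive_energy 3 A (A + A)))\<^sup>2)"
      by (simp add: m_def n_def s_def)
    also have "\<dots> \<le> (54 * s * (3 * K * n\<^sup>2 * h)) ^ 6 *
        ((n * m) ^ 3 * (3 * K * m\<^sup>2 * h) * (3 * K * s\<^sup>2 * h)\<^sup>2)"
      using energy[OF fin] energy[OF finite_P] energy[OF finite_set_plus[OF fin fin]] nonneg \<open>n > 0\<close>
      unfolding n_def[symmetric] m_def[symmetric] s_def[symmetric]
      by (intro mult_mono power_mono mult_left_mono) auto
    also have "\<dots> = (n ^ 15 * m ^ 5) * (54 ^ 6 * 3 ^ 9 * s ^ 10 * K ^ 9 * h ^ 9)" by algebra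
    also have "(m * t * n\<^sup>2) ^ 12 = (n ^ 15 * m ^ 5) * (m ^ 7 * real t ^ 12 * n ^ 9)" by algebra
    finally show ?thesis using \<open>n > 0\<close> nonneg False by (simp add: mult_le_cancel_left_pos)
  qed (use nonneg in simp)
  then show ?thesis by (simp add: P_def n_def s_def m_def h_def)
qed

lemma card_popular_diffs_core_power9_le:
  fixes A A' :: "'a::ab_group_add set"
  assumes K: "Szemeredi_Trotter_set A K" and fin: "finite A" and "A \<noteq> {}"
    and core: "popular_core A A'" and t: "t > 0"
  shows "(card (popular_diffs A' A' t) * (real t)\<^sup>2) ^ 9 * real (card A) ^ 5
    \<le> 54 ^ 6 * 3 ^ 9 * real (card (A + A)) ^ 10 * K ^ 11 * harm (card A) ^ 9"
proof -
  define n s m h where "n = real (card A)" and "s = real (card (A + A))"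
    and "m = real (card (popular_diffs A' A' t))" and "h = (harm (card A) :: real)"
  have "n > 0" using \<open>A \<noteq> {}\<close> fin by (simp add: n_def card_gt_0_iff)
  have nonneg: "K \<ge> 0" "h \<ge> 0" "s \<ge> 0" "m \<ge> 0"
    using Szemeredi_Trotter_set_nonneg[OF K] by (auto simp: h_def s_def m_def harm_nonneg)
  have seventh: "m ^ 7 * real t ^ 12 * n ^ 9 \<le> 54 ^ 6 * 3 ^ 9 * s ^ 10 * K ^ 9 * h ^ 9"
    unfolding m_def n_def s_def h_def by (rule card_popular_diffs_core_power7_le[OF assms])
  have "A' \<subseteq> A" "finite A'" using core fin by (auto simp: popular_core_def intro: finite_subset)
  then have "m * real t ^ 3 \<le> K * (real (card A'))\<^sup>2"
    unfolding m_def using Szemeredi_Trotter_setD[OF Szemeredi_Trotter_set_subset[OF K fin]] t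
    by blast
  also have "\<dots> \<le> K * n\<^sup>2"
    unfolding n_def using nonneg card_mono[OF fin \<open>A' \<subseteq> A\<close>]
    by (intro mult_left_mono power_mono) auto
  finally have cube: "m * real t ^ 3 \<le> K * n\<^sup>2" .
  have "n ^ 4 * ((m * (real t)\<^sup>2) ^ 9 * n ^ 5) = (m ^ 7 * real t ^ 12 * n ^ 9) * (m * real t ^ 3)\<^sup>2"
    by algebra
  also have "\<dots> \<le> (54 ^ 6 * 3 ^ 9 * s ^ 10 * K ^ 9 * h ^ 9) * (K * n\<^sup>2)\<^sup>2"
    by (rule mult_mono[OF seventh power_mono[OF cube]]) (use nonneg in auto)
  also have "\<dots> = n ^ 4 * (54 ^ 6 * 3 ^ 9 * s ^ 10 * K ^ 11 * h ^ 9)" by algebra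
  finally show ?thesis
    using \<open>n > 0\<close> by (simp add: mult_le_cancel_left_pos n_def s_def m_def h_def)
qed

lemma additive_energy_core_power9_le:
  fixes A A' :: "'a::ab_group_add set"
  assumes K: "Szemeredi_Trotter_set A K" and fin: "finite A" and nonempty: "A \<noteq> {}"
    and core: "popular_core A A'"
  shows "real (additive_energy 2 A' A') ^ 9 * real (card A) ^ 5
    \<le> 2 ^ 9 * 54 ^ 6 * 3 ^ 9 * real (card (A + A)) ^ 10 * K ^ 11 * harm (card A) ^ 18"
proof -
  define n s h M e where "n = real (card A)" and "s = real (card (A + A))"
    and "h = (harm (card A) :: real)" and "M = 54 ^ 6 * 3 ^ 9 * s ^ 10 * K ^ 11 * h ^ 9"
    and "e = root 9 (M / n ^ 5)"
  have A': "A' \<subseteq> A" "finite A'" using core fin by (auto simp: popular_core_def intro: finite_subset)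
  have "n > 0" using nonempty fin by (simp add: n_def card_gt_0_iff)
  have nonneg: "h \<ge> 0" "M \<ge> 0" "e \<ge> 0"
    using Szemeredi_Trotter_set_nonneg[OF K] \<open>n > 0\<close>
    by (auto simp: s_def h_def M_def e_def harm_nonneg)
  have e_power: "e ^ 9 * n ^ 5 = M" using \<open>n > 0\<close> by (simp add: e_def odd_real_root_pow)
  have level: "card (popular_diffs A' A' t) * real t ^ 2 \<le> e" if "t > 0" for t
  proof -
    have "(card (popular_diffs A' A' t) * real t ^ 2) ^ 9 * n ^ 5 \<le> e ^ 9 * n ^ 5"
      unfolding e_power unfolding n_def M_def s_def h_def
      by (rule card_popular_diffs_core_power9_le[OF K fin nonempty core that])
    then show ?thesis using \<open>n > 0\<close> nonneg by simp
  qed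
  have "additive_energy 2 A' A' \<le> 2 * e * harm (card A')"
    using additive_energy_le_harm[OF A'(2,2) _ level] by simp
  also have "\<dots> \<le> 2 * e * h"
    unfolding h_def using nonneg card_mono[OF fin A'(1)] by (intro mult_left_mono harm_mono) auto
  finally have "real (additive_energy 2 A' A') ^ 9 * n ^ 5 \<le> (2 * e * h) ^ 9 * n ^ 5"
    using \<open>n > 0\<close> by (intro mult_right_mono power_mono) auto
  also have "\<dots> = 2 ^ 9 * h ^ 9 * M" by (simp add: power_mult_distrib flip: e_power)
  also have "\<dots> = 2 ^ 9 * 54 ^ 6 * 3 ^ 9 * s ^ 10 * K ^ 11 * h ^ 18" unfolding M_def by algebra
  finally show ?thesis by (simp only: n_def s_def h_def)
qed

lemma Szemeredi_Trotter_set_sumset_bound: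
  fixes A :: "'a::ab_group_add set"
  assumes K: "Szemeredi_Trotter_set A K" and fin: "finite A" and nonempty: "A \<noteq> {}"
  shows "real (card A) ^ 41
    \<le> 32 ^ 9 * 54 ^ 6 * 3 ^ 9 * real (card (A + A)) ^ 19 * K ^ 11 * harm (card A) ^ 18"
proof -
  obtain A' where core: "popular_core A A'" and half: "card A \<le> 2 * card A'"
    using exists_popular_core[OF fin] by blast
  have "A' \<subseteq> A" using core by (simp add: popular_core_def)
  define n s h E where "n = real (card A)" and "s = real (card (A + A))"
    and "h = (harm (card A) :: real)" and "E = real (additive_energy 2 A' A')"
  have "real (card A ^ 4) \<le> real (16 * card (A + A) * additive_energy 2 A' A')"
    by (rule of_nat_mono[OF card_power4_le_energy_of_half[OF fin \<open>A' \<subseteq> A\<close> half]])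
  then have "n ^ 4 \<le> 16 * s * E" by (simp add: n_def s_def E_def)
  then have "(n ^ 4) ^ 9 * n ^ 5 \<le> (16 * s * E) ^ 9 * n ^ 5"
    by (intro mult_right_mono power_mono) (auto simp: n_def)
  also have "\<dots> = (16 * s) ^ 9 * (E ^ 9 * n ^ 5)" by (simp add: power_mult_distrib)
  also have "\<dots> \<le> (16 * s) ^ 9 * (2 ^ 9 * 54 ^ 6 * 3 ^ 9 * s ^ 10 * K ^ 11 * h ^ 18)"
    unfolding n_def s_def h_def E_def
    by (intro mult_left_mono additive_energy_core_power9_le[OF K fin nonempty core]) auto
  also have "\<dots> = 32 ^ 9 * 54 ^ 6 * 3 ^ 9 * s ^ 19 * K ^ 11 * h ^ 18" by algebra
  finally show ?thesis by (simp add: n_def s_def h_def flip: power_mult power_add)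
qed

lemma sumset_ratio_bound:
  fixes A P :: "real set" and T :: real
  assumes fin: "finite A" "finite P" and P: "0 \<notin> P" "card A \<le> card P"
    and T: "T > 0" and reps: "\<And>a. a \<in> A \<Longrightarrow> real (ratio_reps P P a) \<ge> T"
  shows "real (card A) ^ 41 * T ^ 33 \<le> 32 ^ 9 * 54 ^ 6 * 3 ^ 9 * 512 ^ 11 * (1 + ln (card A)) ^ 18 *
    (real (card (A + A)) ^ 19 * real (card P) ^ 44)"
proof (cases "A = {}")
  case False
  define K C where "K = 512 * real (card P) ^ 4 / T ^ 3" and "C = (32 ^ 9 * 54 ^ 6 * 3 ^ 9 :: real)"
  have "Szemeredi_Trotter_set A K"
    unfolding K_def by (rule Szemeredi_Trotter_set_if_ratio_reps_ge[OF fin P T reps])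
  then have "real (card A) ^ 41 \<le> C * real (card (A + A)) ^ 19 * K ^ 11 * harm (card A) ^ 18"
    unfolding C_def by (rule Szemeredi_Trotter_set_sumset_bound[OF _ fin(1) False])
  also have "\<dots> \<le> C * real (card (A + A)) ^ 19 * K ^ 11 * (1 + ln (card A)) ^ 18"
    using euler_mascheroni_sequence_decreasing[of 1 "card A"] False fin T
    by (intro mult_left_mono power_mono)
      (auto simp: Suc_le_eq card_gt_0_iff harm_nonneg harm_expand C_def K_def)
  finally have "real (card A) ^ 41 * T ^ 33
      \<le> C * real (card (A + A)) ^ 19 * K ^ 11 * (1 + ln (card A)) ^ 18 * T ^ 33"
    using T by (intro mult_right_mono) auto
  also have "\<dots> = C * (1 + ln (card A)) ^ 18 * real (card (A + A)) ^ 19 * (K ^ 11 * T ^ 33)"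
    by (simp only: mult_ac)
  also have "K ^ 11 * T ^ 33 = 512 ^ 11 * real (card P) ^ 44"
    using T by (simp add: K_def power_divide power_mult_distrib flip: power_mult)
  finally show ?thesis by (simp only: C_def mult_ac)
qed simp

lemma sumset_ratio_bound_trivial:
  fixes A P :: "real set" and T :: real
  assumes fin: "finite A" "finite P" and P: "0 \<notin> P"
    and T: "T \<ge> 1" and reps: "\<And>a. a \<in> A \<Longrightarrow> real (ratio_reps P P a) \<ge> T" and "card A \<le> 1"
  shows "real (card A) * T ^ 33 \<le> real (card (A + A)) ^ 19 * real (card P) ^ 44"
proof (cases "A = {}")
  case False
  have T_le: "T \<le> card P" by (rule le_card_if_ratio_reps_ge[OF fin(2) P False reps])
  have "card (A + A) > 0"
    using fin False by (auto simp: card_gt_0_iff finite_set_plus set_plus_def)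
  have "real (card A) * T ^ 33 \<le> 1 * real (card P) ^ 33"
    using \<open>card A \<le> 1\<close> T T_le by (intro mult_mono power_mono) auto
  also have "\<dots> \<le> 1 * real (card P) ^ 44" using T T_le by (simp add: power_increasing)
  also have "\<dots> \<le> real (card (A + A)) ^ 19 * real (card P) ^ 44"
    using \<open>card (A + A) > 0\<close> by (intro mult_right_mono) auto
  finally show ?thesis .
qed simp

lemma exists_exponent_absorbing_log_power:
  fixes C :: real
  assumes "C > 0"
  obtains \<epsilon> :: "nat \<Rightarrow> real" where "\<epsilon> \<longlonglongrightarrow> 0"
    "\<And>n d x y. real n ^ d * x \<le> C * (1 + ln (real n)) ^ k * y \<Longrightarrow>
      (n \<le> 1 \<Longrightarrow> real n * x \<le> y) \<Longrightarrow> real n powr (real d - \<epsilon> n) * x \<le> y"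
proof
  define g where "g n = C * (1 + ln (real n)) ^ k" for n
  define \<epsilon> where "\<epsilon> n = ln (g n) / ln (real n)" for n
  show "\<epsilon> \<longlonglongrightarrow> 0" unfolding \<epsilon>_def g_def using assms by real_asymp
  fix n d :: nat and x y :: real
  assume bound: "real n ^ d * x \<le> C * (1 + ln (real n)) ^ k * y"
    and trivial: "n \<le> 1 \<Longrightarrow> real n * x \<le> y"
  show "real n powr (real d - \<epsilon> n) * x \<le> y"
  proof (cases "n \<le> 1")
    case True
    then show ?thesis using trivial by (cases n) auto
  next
    case False
    then have "1 + ln (real n) > 0" by (simp add: add_pos_nonneg)
    then have "g n > 0" using assms by (simp add: g_def)
    then have "real n powr \<epsilon> n = g n" using False by (simp add: powr_def \<epsilon>_def)
    then have "real n powr (real d - \<epsilon> n) = real n ^ d / g n"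
      using False by (simp add: powr_diff powr_realpow)
    then show ?thesis
      using bound \<open>g n > 0\<close> by (simp add: pos_divide_le_eq mult.commute g_def[symmetric])
  qed
qed

text \<open>Frees \<open>\<Pi>\<close> from its role as the dependent function space binder.\<close>

no_syntax
  "_Pi" :: "pttrn \<Rightarrow> 'a set \<Rightarrow> 'b set \<Rightarrow> ('a \<Rightarrow> 'b) set"
    (\<open>(\<open>indent=3 notation=\<open>binder \<Pi>\<in>\<close>\<close>\<Pi> _\<in>_./ _)\<close> 10)

theorem theorem1p5:
  shows "\<exists>\<epsilon> :: nat \<Rightarrow> real. \<epsilon> \<longlonglongrightarrow> 0 \<and>
    (\<forall>(A :: real set) (\<Pi> :: real set) (T :: real).
      finite A \<longrightarrow> finite \<Pi> \<longrightarrow> A \<subseteq> UNIV - {0} \<longrightarrow> \<Pi> \<subseteq> UNIV - {0} \<longrightarrow>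
      card \<Pi> \<ge> card A \<longrightarrow> T \<ge> 1 \<longrightarrow>
      (\<forall>a\<in>A. real (ratio_reps \<Pi> \<Pi> a) \<ge> T) \<longrightarrow>
      real (card (A + A)) ^ 19 * real (card \<Pi>) ^ 44
        \<ge> real (card A) powr (41 - \<epsilon> (card A)) * T ^ 33)"
proof (rule exists_exponent_absorbing_log_power)
  show "(32 ^ 9 * 54 ^ 6 * 3 ^ 9 * 512 ^ 11 :: real) > 0" by simp
  fix \<epsilon> :: "nat \<Rightarrow> real"
  assume lim: "\<epsilon> \<longlonglongrightarrow> 0" and absorb: "\<And>n d x y.
    real n ^ d * x \<le> 32 ^ 9 * 54 ^ 6 * 3 ^ 9 * 512 ^ 11 * (1 + ln (real n)) ^ 18 * y \<Longrightarrow>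
    (n \<le> 1 \<Longrightarrow> real n * x \<le> y) \<Longrightarrow> real n powr (real d - \<epsilon> n) * x \<le> y"
  show ?thesis
  proof (intro exI conjI allI impI)
    fix A \<Pi> :: "real set" and T :: real
    assume fin: "finite A" "finite \<Pi>" and "\<Pi> \<subseteq> UNIV - {0}" and card_le: "card \<Pi> \<ge> card A"
      and T: "T \<ge> 1" and "\<forall>a\<in>A. real (ratio_reps \<Pi> \<Pi> a) \<ge> T"
    then have \<Pi>: "0 \<notin> \<Pi>" and reps: "\<And>a. a \<in> A \<Longrightarrow> real (ratio_reps \<Pi> \<Pi> a) \<ge> T" by auto
    have "real (card A) powr (real 41 - \<epsilon> (card A)) * T ^ 33
        \<le> real (card (A + A)) ^ 19 * real (card \<Pi>) ^ 44"
      using sumset_ratio_bound[OF fin \<Pi> card_le _ reps] T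
        sumset_ratio_bound_trivial[OF fin \<Pi> T reps] by (intro absorb) auto
    then show "real (card (A + A)) ^ 19 * real (card \<Pi>) ^ 44
        \<ge> real (card A) powr (41 - \<epsilon> (card A)) * T ^ 33" by simp
  qed (rule lim)
qed

end
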